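(* Let $\varphi:\mathbb{R}^n\to\mathbb{R}$ be a $\mathcal{C}^{1,1}$-smooth function. If $\varphi$ is quasiconvex, then for all $x,u\in\mathbb{R}^n$ with $\langle\nabla\varphi(x),u\rangle=0$ there exists $z\in\partial^2\varphi(x)(u)$ such that $\langle z,u\rangle\ge 0$.
   Context: $\mathcal{C}^{1,1}$-smooth: $\varphi$ is Fréchet differentiable on $\mathbb{R}^n$ and its gradient $\nabla\varphi:\mathbb{R}^n\to\mathbb{R}^n$ is locally Lipschitz. Quasiconvex: $\varphi((1-\lambda)x+\lambda y)\le\max\{\varphi(x),\varphi(y)\}$ for all $x,y\in\mathbb{R}^n$ and $\lambda\in[0,1]$. For a proper lower semicontinuous $\psi:\mathbb{R}^m\to(-\infty,\infty]$ and $\bar x$ with $\psi(\bar x)<\infty$, the Fréchet subdifferential is $\widehat\partial\psi(\bar x)=\{x^*\in\mathbb{R}^m : \liminf_{x\to\bar x}\frac{\psi(x)-\psi(\bar x)-\langle x^*,x-\bar x\rangle}{\|x-\bar x\|}\ge 0\}$. The Mordukhovich subdifferential $\partial\psi(\bar x)$ is the set of all $x^*$ for which there are sequences $x_k\to\bar x$ with $\psi(x_k)\to\psi(\bar x)$ and $x_k^*\to x^*$ with $x_k^*\in\widehat\partial\psi(x_k)$ for all $k$. For a set $\Omega$ and $p\in\Omega$, the Mordukhovich normal cone is $N(p;\Omega)=\partial\delta_\Omega(p)$, where $\delta_\Omega$ equals $0$ on $\Omega$ and $\infty$ elsewhere. Mordukhovich second-order subdifferential of a $\mathcal{C}^{1,1}$-smooth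 $\varphi$: it is the Mordukhovich coderivative of the gradient mapping, i.e. for $x,u\in\mathbb{R}^n$, $\partial^2\varphi(x)(u)=\{z\in\mathbb{R}^n : (z,-u)\in N((x,\nabla\varphi(x));\mathrm{gph}\,\nabla\varphi)\}$, where $\mathrm{gph}\,\nabla\varphi=\{(y,\nabla\varphi(y)) : y\in\mathbb{R}^n\}\subset\mathbb{R}^n\times\mathbb{R}^n$. *)

theory Defs
  imports "HOL-Analysis.Analysis"
begin

text \<open>
  The functions considered take values in $(-\infty,\infty]$, rendered as \<open>ereal\<close>. Both
  subdifferentials are empty at points where the function is not finite. In the Frechet
  subdifferential, the filter \<open>at p\<close> omits \<open>p\<close> itself, so the denominator is positive.
\<close>

definition frechet_subdifferential :: "('a::euclidean_space \<Rightarrow> ereal) \<Rightarrow> 'a \<Rightarrow> 'a set" where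
  "frechet_subdifferential \<psi> p =
     {v. \<bar>\<psi> p\<bar> \<noteq> \<infinity> \<and>
         Liminf (at p) (\<lambda>x. (\<psi> x - \<psi> p - ereal (v \<bullet> (x - p))) / ereal (norm (x - p))) \<ge> 0}"

definition mordukhovich_subdifferential :: "('a::euclidean_space \<Rightarrow> ereal) \<Rightarrow> 'a \<Rightarrow> 'a set" where
  "mordukhovich_subdifferential \<psi> p =
     {v. \<bar>\<psi> p\<bar> \<noteq> \<infinity> \<and>
         (\<exists>(x :: nat \<Rightarrow> 'a) (w :: nat \<Rightarrow> 'a).
            x \<longlonglongrightarrow> p \<and> (\<lambda>k. \<psi> (x k)) \<longlonglongrightarrow> \<psi> p \<and> w \<longlonglongrightarrow> v \<and>
            (\<forall>k. w k \<in> frechet_subdifferential \<psi> (x k)))}"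

definition indicator_fun :: "'a set \<Rightarrow> 'a \<Rightarrow> ereal" where
  "indicator_fun \<Omega> x = (if x \<in> \<Omega> then 0 else \<infinity>)"

definition mordukhovich_normal_cone :: "'a::euclidean_space \<Rightarrow> 'a set \<Rightarrow> 'a set" where
  "mordukhovich_normal_cone p \<Omega> = mordukhovich_subdifferential (indicator_fun \<Omega>) p"

definition graph_of :: "('a \<Rightarrow> 'b) \<Rightarrow> ('a \<times> 'b) set" where
  "graph_of F = {(y, F y) | y. True}"

definition mordukhovich_coderivative ::
    "('a::euclidean_space \<Rightarrow> 'b::euclidean_space) \<Rightarrow> 'a \<Rightarrow> 'b \<Rightarrow> 'a set" where
  "mordukhovich_coderivative F x u =
     {z. (z, - u) \<in> mordukhovich_normal_cone (x, F x) (graph_of F)}"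

text \<open>
  The gradient is the Riesz representative of the Frechet derivative; it is meaningful only
  where the function is differentiable (see \<open>GDERIV_gradient\<close>).
\<close>

definition gradient :: "('a::euclidean_space \<Rightarrow> real) \<Rightarrow> 'a \<Rightarrow> 'a" where
  "gradient \<phi> x = (THE g. GDERIV \<phi> x :> g)"

lemma GDERIV_gradient:
  fixes \<phi> :: "'a::euclidean_space \<Rightarrow> real"
  assumes "\<phi> differentiable (at x)"
  shows "GDERIV \<phi> x :> gradient \<phi> x"
proof -
  obtain D where D: "(\<phi> has_derivative D) (at x)"
    using assms by (auto simp: differentiable_def)
  then interpret linear D
    by (rule has_derivative_linear)
  define g where "g = (\<Sum>b\<in>Basis. D b *\<^sub>R b)"
  have "D h = h \<bullet> g" for h
  proof -
    have "D h = D (\<Sum>b\<in>Basis. (h \<bullet> b) *\<^sub>R b)"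
      by (simp add: euclidean_representation)
    also have "\<dots> = h \<bullet> g"
      by (simp add: sum scale g_def inner_sum_right mult.commute)
    finally show ?thesis .
  qed
  then have "D = (\<lambda>h. h \<bullet> g)" by blast
  with D have g: "GDERIV \<phi> x :> g"
    by (simp add: gderiv_def)
  have uniq: "g' = g" if "GDERIV \<phi> x :> g'" for g'
  proof -
    have "(\<lambda>h. h \<bullet> g') = (\<lambda>h. h \<bullet> g)"
      using that g unfolding gderiv_def by (rule has_derivative_unique)
    then show ?thesis
      using vector_eq_ldot[of g' g] by (auto dest: fun_cong)
  qed
  show ?thesis
    unfolding gradient_def using g uniq by (rule theI)
qed

definition locally_lipschitz :: "('a::metric_space \<Rightarrow> 'b::metric_space) \<Rightarrow> bool" where
  "locally_lipschitz F \<longleftrightarrow> (\<forall>x. \<exists>r>0. \<exists>L. L-lipschitz_on (ball x r) F)"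

definition C11_smooth :: "('a::euclidean_space \<Rightarrow> real) \<Rightarrow> bool" where
  "C11_smooth \<phi> \<longleftrightarrow> (\<forall>x. \<phi> differentiable (at x)) \<and> locally_lipschitz (gradient \<phi>)"

definition quasiconvex :: "('a::real_vector \<Rightarrow> real) \<Rightarrow> bool" where
  "quasiconvex \<phi> \<longleftrightarrow>
     (\<forall>x y. \<forall>t\<in>{0..1}. \<phi> ((1 - t) *\<^sub>R x + t *\<^sub>R y) \<le> max (\<phi> x) (\<phi> y))"

definition second_order_subdifferential ::
    "('a::euclidean_space \<Rightarrow> real) \<Rightarrow> 'a \<Rightarrow> 'a \<Rightarrow> 'a set" where
  "second_order_subdifferential \<phi> x u = mordukhovich_coderivative (gradient \<phi>) x u"

end

theory Submission
  imports Defs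
begin

text \<open>
  Write \<open>f = \<langle>\<nabla>\<phi>, u\<rangle>\<close>, so that \<open>f x = 0\<close>. Quasiconvexity prevents \<open>x\<close> from being a strict
  local maximum of \<open>\<phi>\<close> on the line \<open>x + \<real> u\<close>, so by the mean value theorem there are points
  \<open>a\<close> and \<open>b = a + t u\<close> with \<open>t > 0\<close> arbitrarily close to \<open>x\<close> with \<open>f a \<le> f b\<close>. Minimising \<open>f\<close>
  plus a small linear tilt and a quadratic penalty for leaving the segment from \<open>a\<close> to \<open>b\<close> gives
  a proximal subgradient \<open>z\<close> of \<open>f\<close> near \<open>x\<close> with \<open>\<langle>z, u\<rangle>\<close> almost nonnegative. The vectors
  \<open>(z, -u)\<close> are Frechet normals to the graph of \<open>\<nabla>\<phi>\<close>, and the \<open>z\<close> are bounded because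
  \<open>\<nabla>\<phi>\<close> is locally Lipschitz, so a limit point is the required element.
\<close>

section \<open>Proximal subgradients and graph normals\<close>

text \<open>The quadratic error is stronger than the Frechet condition. It is what minimisation with
  a quadratic penalty delivers, and it gives an explicit rate on the graph.\<close>

definition proximal_subgradient :: "('a::real_inner \<Rightarrow> real) \<Rightarrow> 'a \<Rightarrow> 'a \<Rightarrow> bool" where
  "proximal_subgradient f y z \<longleftrightarrow>
     (\<exists>C. \<forall>\<^sub>F y' in nhds y. f y + z \<bullet> (y' - y) - C * (norm (y' - y))\<^sup>2 \<le> f y')"

text \<open>Moving from \<open>y\<close> along \<open>z\<close> itself raises \<open>f\<close> at
  rate \<open>norm z\<close> per unit length, up to an error vanishing with the step, and the
  Lipschitz constant caps this rate. The bound later provides compactness.\<close>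

lemma norm_proximal_subgradient_le:
  fixes f :: "'a::real_inner \<Rightarrow> real"
  assumes lip: "L-lipschitz_on S f" and "open S" "y \<in> S"
    and z: "proximal_subgradient f y z"
  shows "norm z \<le> L"
proof (cases "z = 0")
  case True
  then show ?thesis using lipschitz_on_nonneg[OF lip] by simp
next
  case False
  obtain C where C: "\<forall>\<^sub>F y' in nhds y. f y + z \<bullet> (y' - y) - C * (norm (y' - y))\<^sup>2 \<le> f y'"
    using z unfolding proximal_subgradient_def by blast
  have "\<forall>\<^sub>F y' in nhds y. y' \<in> S"
    using assms(2,3) by (rule eventually_nhds_in_open)
  with C have ev: "\<forall>\<^sub>F y' in nhds y. y' \<in> S \<and> f y + z \<bullet> (y' - y) - C * (norm (y' - y))\<^sup>2 \<le> f y'"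
    by eventually_elim auto
  have "((\<lambda>t::real. y + t *\<^sub>R z) \<longlongrightarrow> y + 0 *\<^sub>R z) (at_right 0)"
    by (intro tendsto_intros)
  then have "filterlim (\<lambda>t::real. y + t *\<^sub>R z) (nhds y) (at_right 0)"
    by simp
  from eventually_compose_filterlim[OF ev this]
  have ev': "\<forall>\<^sub>F t in at_right (0::real). y + t *\<^sub>R z \<in> S \<and>
      f y + z \<bullet> (t *\<^sub>R z) - C * (norm (t *\<^sub>R z))\<^sup>2 \<le> f (y + t *\<^sub>R z)"
    by simp
  \<comment> \<open>Both bounds on the increment of \<open>f\<close> are divided by the step length
    \<open>t * norm z\<close>, which is positive since \<open>z\<close> is nonzero.\<close>
  have "\<forall>\<^sub>F t in at_right (0::real). norm z - C * t * norm z \<le> L"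
    using ev' eventually_at_right_less[of "0::real"]
  proof eventually_elim
    case (elim t)
    have "f (y + t *\<^sub>R z) - f y \<le> (t * norm z) * L"
      using lipschitz_onD[OF lip _ \<open>y \<in> S\<close>, of "y + t *\<^sub>R z"] elim
      by (auto simp: dist_norm mult.commute)
    moreover have "z \<bullet> (t *\<^sub>R z) - C * (norm (t *\<^sub>R z))\<^sup>2 = (t * norm z) * (norm z - C * t * norm z)"
      by (simp add: power_mult_distrib power2_eq_square algebra_simps dot_square_norm)
    ultimately have "(t * norm z) * (norm z - C * t * norm z) \<le> (t * norm z) * L"
      using conjunct2[OF elim(1)] by linarith
    then show ?case
      using elim False by (simp add: mult_le_cancel_left)
  qed
  moreover have "((\<lambda>t. norm z - C * t * norm z) \<longlongrightarrow> norm z - C * 0 * norm z) (at_right 0)"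
    by (intro tendsto_intros)
  ultimately show ?thesis
    using tendsto_upperbound[of "\<lambda>t. norm z - C * t * norm z" "norm z" "at_right 0" L] by simp
qed

text \<open>On the graph, pairing \<open>(z, - u)\<close> with an increment leaves exactly the
  difference that the proximal inequality bounds quadratically; off the graph the quotient is
  infinite.\<close>

lemma proximal_subgradient_imp_frechet_normal:
  fixes F :: "'a::euclidean_space \<Rightarrow> 'b::euclidean_space"
  assumes "proximal_subgradient (\<lambda>y. F y \<bullet> u) y z"
  shows "(z, - u) \<in> frechet_subdifferential (indicator_fun (graph_of F)) (y, F y)"
proof -
  let ?\<psi> = "indicator_fun (graph_of F)" and ?p = "(y, F y)"
  let ?q = "\<lambda>w. (?\<psi> w - ?\<psi> ?p - ereal ((z, - u) \<bullet> (w - ?p))) / ereal (norm (w - ?p))"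
  have p0: "?\<psi> ?p = 0"
    by (simp add: indicator_fun_def graph_of_def)
  obtain C where C: "\<forall>\<^sub>F y' in nhds y. F y \<bullet> u + z \<bullet> (y' - y) - C * (norm (y' - y))\<^sup>2 \<le> F y' \<bullet> u"
    using assms unfolding proximal_subgradient_def by blast
  \<comment> \<open>\<open>C\<close> may be negative; \<open>D\<close> is nonnegative and dominates
    it, so the bound survives replacing \<open>norm (y' - y)\<close> by the larger
    \<open>norm (w - ?p)\<close>.\<close>
  define D where "D = \<bar>C\<bar> + 1"
  have "filterlim fst (nhds y) (at ?p)"
    using tendsto_fst[OF tendsto_ident_at, of ?p UNIV] by simp
  from eventually_compose_filterlim[OF C this]
  have ev: "\<forall>\<^sub>F w in at ?p. F y \<bullet> u + z \<bullet> (fst w - y) - C * (norm (fst w - y))\<^sup>2 \<le> F (fst w) \<bullet> u" .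
  have lower: "\<forall>\<^sub>F w in at ?p. ereal (- D * norm (w - ?p)) \<le> ?q w"
    using ev eventually_neq_at_within[of ?p ?p UNIV]
  proof eventually_elim
    case (elim w)
    then have pos: "norm (w - ?p) > 0" by simp
    show ?case
    proof (cases "w \<in> graph_of F")
      case False
      then have "?q w = \<infinity>"
        using pos p0 by (simp add: indicator_fun_def)
      then show ?thesis by simp
    next
      case True
      then obtain y' where w: "w = (y', F y')"
        by (auto simp: graph_of_def)
      have "norm (y' - y) \<le> norm (w - ?p)"
        using norm_fst_le[of "y' - y" "F y' - F y"] by (simp add: w)
      then have "(norm (y' - y))\<^sup>2 \<le> (norm (w - ?p))\<^sup>2"
        by (simp add: power_mono)
      then have "C * (norm (y' - y))\<^sup>2 \<le> D * (norm (w - ?p))\<^sup>2"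
        unfolding D_def by (intro mult_mono) auto
      moreover have "(z, - u) \<bullet> (w - ?p) = z \<bullet> (y' - y) - F y' \<bullet> u + F y \<bullet> u"
        by (simp add: w inner_diff_right inner_commute)
      ultimately have "(z, - u) \<bullet> (w - ?p) \<le> D * (norm (w - ?p))\<^sup>2"
        using elim by (simp add: w)
      then have "- D * norm (w - ?p) \<le> (- ((z, - u) \<bullet> (w - ?p))) / norm (w - ?p)"
        unfolding pos_le_divide_eq[OF pos] by (simp add: power2_eq_square mult.assoc)
      moreover have "?\<psi> w = 0"
        using True by (simp add: indicator_fun_def)
      ultimately show ?thesis
        using p0 pos by (simp add: zero_ereal_def)
    qed
  qed
  have "((\<lambda>w. - D * norm (w - ?p)) \<longlongrightarrow> - D * norm (?p - ?p)) (at ?p)"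
    by (intro tendsto_intros)
  then have "((\<lambda>w. ereal (- D * norm (w - ?p))) \<longlongrightarrow> 0) (at ?p)"
    by (simp add: zero_ereal_def)
  then have "Liminf (at ?p) (\<lambda>w. ereal (- D * norm (w - ?p))) = 0"
    by (intro lim_imp_Liminf) auto
  then have "0 \<le> Liminf (at ?p) ?q"
    using Liminf_mono[OF lower] by simp
  then show ?thesis
    unfolding frechet_subdifferential_def using p0 by simp
qed

section \<open>Approximate mean value inequality\<close>

text \<open>The sum of \<open>f\<close> and a tilted penalty \<open>Q\<close> is minimised over a
  tube \<open>K\<close> around the segment. The minimiser turns out to be interior, so minus the
  gradient of \<open>Q\<close> there is a proximal subgradient of \<open>f\<close>.\<close>

lemma proximal_mean_value_inequality:
  fixes f :: "'a::euclidean_space \<Rightarrow> real"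
  assumes lip: "L-lipschitz_on (ball x r) f"
    and e: "norm e = 1" and t: "t > 0" and a: "a \<in> ball x r" and b: "a + t *\<^sub>R e \<in> ball x r"
    and le: "f a \<le> f (a + t *\<^sub>R e)" and eps: "\<epsilon> > 0"
  obtains y z where "y \<in> ball x r" "proximal_subgradient f y z" "- \<epsilon> \<le> z \<bullet> e"
proof -
  have ee: "e \<bullet> e = 1"
    using e by (simp add: norm_eq_1)
  define R where "R = max (dist x a) (dist x (a + t *\<^sub>R e))"
  \<comment> \<open>The segment lies in \<open>cball x R\<close> and each point of the tube is
    within \<open>2 * \<rho>\<close> of it, so a third of the gap keeps the tube inside the
    ball.\<close>
  define \<rho> where "\<rho> = (r - R) / 3"
  have R: "R < r" and \<rho>: "\<rho> > 0" and R\<rho>: "R + 2 * \<rho> < r"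
    using a b by (auto simp: R_def \<rho>_def field_simps)
  have L: "L \<ge> 0" using lipschitz_on_nonneg[OF lip] .
  define s where "s y = (y - a) \<bullet> e" for y
  define v where "v y = (y - a) - s y *\<^sub>R e" for y
  \<comment> \<open>Only positions behind \<open>a\<close> are penalised along \<open>e\<close>, so
    the derivative of this penalty has one sign; the square of \<open>m\<close> remains continuously
    differentiable.\<close>
  define m where "m y = min 0 (s y)" for y
  \<comment> \<open>The first term makes the penalty at distance \<open>\<rho>\<close> exceed any
    possible drop of \<open>f\<close> plus the gain from the tilt (\<open>k1\<close>). The second
    makes the discriminant in the exclusion of \<open>s y = t\<close> negative (\<open>k2\<close>).
    The added ones give strictness.\<close>
  define k where "k = (L * (2 * r) + \<epsilon> * \<rho> + 1) / \<rho>\<^sup>2 + L\<^sup>2 / (4 * \<epsilon> * t) + 1"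
  have r: "r > 0" using a by (auto simp: dist_commute intro: le_less_trans[OF zero_le_dist])
  have k0: "k > 0"
    using \<rho> r L eps t by (auto simp: k_def intro!: add_nonneg_pos add_nonneg_nonneg)
  have k1: "L * (2 * r) + \<epsilon> * \<rho> < k * \<rho>\<^sup>2"
  proof -
    have "L * (2 * r) + \<epsilon> * \<rho> < (L * (2 * r) + \<epsilon> * \<rho> + 1) / \<rho>\<^sup>2 * \<rho>\<^sup>2"
      using \<rho> by simp
    also have "\<dots> \<le> k * \<rho>\<^sup>2"
      unfolding k_def using eps t by (intro mult_right_mono) auto
    finally show ?thesis .
  qed
  have k2: "L\<^sup>2 < 4 * k * (\<epsilon> * t)"
  proof -
    have "L\<^sup>2 / (4 * \<epsilon> * t) < k"
      unfolding k_def using \<rho> r L eps by (intro less_le_trans[OF less_add_one]) auto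
    then show ?thesis
      using eps t by (simp add: pos_divide_less_eq mult_ac)
  qed
  define Q where "Q y = \<epsilon> * s y + k * (norm (v y))\<^sup>2 + k * (m y)\<^sup>2" for y
  \<comment> \<open>The tube extends past \<open>a\<close> by \<open>\<rho>\<close> but stops
    exactly at the far endpoint: there the tilt, not the penalty, has to exclude the
    minimiser.\<close>
  define K where "K = {y. - \<rho> \<le> s y \<and> s y \<le> t \<and> norm (v y) \<le> \<rho>}"
  have cont: "continuous_on A s" "continuous_on A (\<lambda>y. norm (v y))" "continuous_on A Q" for A
    unfolding Q_def m_def v_def s_def by (intro continuous_intros)+
  have decomp: "y = a + s y *\<^sub>R e + v y" for y
    by (simp add: v_def)
  have K_ball: "y \<in> ball x r" if "y \<in> K" for y
  proof -
    define c where "c = max 0 (s y)"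
    have c: "0 \<le> c" "c \<le> t"
      using that t by (auto simp: c_def K_def)
    have "a + c *\<^sub>R e \<in> closed_segment a (a + t *\<^sub>R e)"
      using c t by (auto simp: closed_segment_def algebra_simps intro!: exI[of _ "c / t"])
    moreover have "closed_segment a (a + t *\<^sub>R e) \<subseteq> cball x R"
      by (intro closed_segment_subset) (auto simp: R_def)
    ultimately have 1: "dist x (a + c *\<^sub>R e) \<le> R" by auto
    have "dist (a + c *\<^sub>R e) y = norm ((c - s y) *\<^sub>R e - v y)"
      by (subst decomp[of y]) (simp add: dist_norm algebra_simps)
    also have "\<dots> \<le> \<bar>c - s y\<bar> + norm (v y)"
      using norm_triangle_ineq4[of "(c - s y) *\<^sub>R e" "v y"] e by simp
    also have "\<dots> \<le> \<rho> + \<rho>"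
      using that \<rho> by (intro add_mono) (auto simp: c_def K_def)
    finally show ?thesis
      using 1 R\<rho> dist_triangle[of x y "a + c *\<^sub>R e"] by simp
  qed
  have "closed K"
    unfolding K_def
    by (intro closed_Collect_conj closed_Collect_le cont continuous_intros)
  moreover have "bounded K"
    using K_ball bounded_ball bounded_subset by (metis subsetI)
  ultimately have "compact K"
    by (simp add: compact_eq_bounded_closed)
  have [simp]: "s a = 0" "v a = 0" "m a = 0" by (auto simp: s_def v_def m_def)
  have aK: "a \<in> K"
    using \<rho> t by (simp add: K_def)
  have "continuous_on K f"
    using lipschitz_on_continuous_on[OF lip] by (rule continuous_on_subset) (use K_ball in auto)
  then have "continuous_on K (\<lambda>y. f y + Q y)"
    by (intro continuous_intros cont)
  with \<open>compact K\<close> aK obtain y where y: "y \<in> K" and ymin: "\<And>y'. y' \<in> K \<Longrightarrow> f y + Q y \<le> f y' + Q y'"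
    using continuous_attains_inf[of K "\<lambda>y. f y + Q y"] by blast
  have ya: "f y + Q y \<le> f a"
    using ymin[OF aK] by (simp add: Q_def)
  have "\<bar>f y - f a\<bar> \<le> L * dist y a"
    using lipschitz_onD[OF lip K_ball[OF y] a] by (simp add: dist_norm)
  also have "\<dots> \<le> L * (2 * r)"
    using L K_ball[OF y] a dist_triangle2[of y a x]
    by (intro mult_left_mono) (auto simp: dist_commute)
  finally have fya: "f a - L * (2 * r) \<le> f y" by linarith
  have s_ge: "- (\<epsilon> * \<rho>) \<le> \<epsilon> * s y"
    using y eps mult_left_mono[of "- \<rho>" "s y" \<epsilon>] by (simp add: K_def)
  \<comment> \<open>\<open>Q\<close> vanishes at \<open>a\<close>, so the minimal value is at most
    \<open>f a\<close>. By \<open>k1\<close> neither penalty can then reach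
    \<open>k * \<rho>\<^sup>2\<close>, which rules out the lateral face and, below, the rear
    one.\<close>
  have "k * (norm (v y))\<^sup>2 < k * \<rho>\<^sup>2"
    using ya fya s_ge k1 k0 unfolding Q_def by (smt (verit) zero_le_power2 mult_nonneg_nonneg)
  then have v_less: "norm (v y) < \<rho>"
    using k0 \<rho> by (simp add: power_less_imp_less_base)
  have "k * (m y)\<^sup>2 < k * \<rho>\<^sup>2"
    using ya fya s_ge k1 k0 unfolding Q_def by (smt (verit) zero_le_power2 mult_nonneg_nonneg)
  then have "\<bar>m y\<bar> < \<rho>"
    using k0 \<rho> abs_le_square_iff[of \<rho> "m y"] by (auto simp flip: not_le)
  then have s_gt: "- \<rho> < s y"
    by (auto simp: m_def min_def split: if_splits)
  \<comment> \<open>On this face \<open>f y\<close> is at least \<open>f a - L * norm (v y)\<close>,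
    while \<open>Q\<close> costs at least \<open>\<epsilon> * t\<close>. Minimality would make a
    quadratic in \<open>norm (v y)\<close> nonpositive although its discriminant is negative, as
    completing the square shows.\<close>
  have "s y \<noteq> t"
  proof
    assume st: "s y = t"
    have "\<bar>f y - f (a + t *\<^sub>R e)\<bar> \<le> L * dist y (a + t *\<^sub>R e)"
      using lipschitz_onD[OF lip K_ball[OF y] b] by (simp add: dist_norm)
    also have "dist y (a + t *\<^sub>R e) = norm (v y)"
      by (simp add: v_def st dist_norm algebra_simps)
    finally have "f a - L * norm (v y) \<le> f y" using le by linarith
    with ya have "\<epsilon> * t + k * (norm (v y))\<^sup>2 - L * norm (v y) \<le> 0"
      using st t by (simp add: Q_def m_def)
    then have "4 * k * (\<epsilon> * t + k * (norm (v y))\<^sup>2 - L * norm (v y)) \<le> 0"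
      using k0 by (simp add: mult_le_0_iff)
    also have "4 * k * (\<epsilon> * t + k * (norm (v y))\<^sup>2 - L * norm (v y))
        = (2 * k * norm (v y) - L)\<^sup>2 + (4 * k * (\<epsilon> * t) - L\<^sup>2)"
      by (simp add: power2_eq_square algebra_simps)
    finally show False
      using k2 zero_le_power2[of "2 * k * norm (v y) - L"] by linarith
  qed
  then have s_less: "s y < t" using y by (simp add: K_def)
  have "open {y. - \<rho> < s y \<and> s y < t \<and> norm (v y) < \<rho>}"
    by (intro open_Collect_conj open_Collect_less cont continuous_intros)
  then have ev: "\<forall>\<^sub>F y' in nhds y. y' \<in> K"
    using s_gt s_less v_less by (auto simp: eventually_nhds K_def intro: less_imp_le)
  \<comment> \<open>Minus the gradient of \<open>Q\<close> at \<open>y\<close>.\<close>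
  define z where "z = - ((\<epsilon> + 2 * k * m y) *\<^sub>R e + (2 * k) *\<^sub>R v y)"
  have Q_le: "Q y' - Q y \<le> - (z \<bullet> (y' - y)) + 2 * k * (norm (y' - y))\<^sup>2" for y'
  proof -
    define d where "d = y' - y"
    have s': "s y' = s y + d \<bullet> e"
      by (simp add: s_def d_def inner_diff_left)
    have v': "v y' = v y + (d - (d \<bullet> e) *\<^sub>R e)"
      by (simp add: v_def s' d_def algebra_simps)
    have ve: "v y \<bullet> e = 0" "e \<bullet> v y = 0"
      by (simp_all add: v_def s_def inner_diff_left inner_diff_right ee inner_commute)
    have "(norm (v y'))\<^sup>2 = (norm (v y))\<^sup>2 + 2 * (v y \<bullet> d) + ((norm d)\<^sup>2 - (d \<bullet> e)\<^sup>2)"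
      unfolding v' power2_norm_eq_inner
      by (simp add: inner_simps ve ee inner_commute power2_eq_square algebra_simps)
    then have 1: "(norm (v y'))\<^sup>2 - (norm (v y))\<^sup>2 \<le> 2 * (v y \<bullet> d) + (norm d)\<^sup>2"
      by simp
    \<comment> \<open>The truncated square lies below its tangent plus a full square: for
      \<open>s y < 0\<close> by comparison with the untruncated square, otherwise because
      \<open>m y = 0\<close>.\<close>
    have "(m y')\<^sup>2 \<le> (m y)\<^sup>2 + 2 * m y * (d \<bullet> e) + (d \<bullet> e)\<^sup>2"
    proof (cases "s y < 0")
      case True
      have "(m y')\<^sup>2 \<le> (s y')\<^sup>2" by (auto simp: m_def min_def)
      then show ?thesis
        using True by (simp add: m_def s' power2_eq_square algebra_simps)
    next
      case False
      have "\<bar>m y'\<bar> \<le> \<bar>d \<bullet> e\<bar>" using False by (auto simp: m_def s')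
      then have "(m y')\<^sup>2 \<le> (d \<bullet> e)\<^sup>2" by (simp only: abs_le_square_iff)
      then show ?thesis using False by (simp add: m_def)
    qed
    moreover have "(d \<bullet> e)\<^sup>2 \<le> (norm d)\<^sup>2"
      using Cauchy_Schwarz_ineq2[of d e] e by (simp flip: abs_le_square_iff)
    ultimately have 2: "(m y')\<^sup>2 - (m y)\<^sup>2 \<le> 2 * m y * (d \<bullet> e) + (norm d)\<^sup>2"
      by linarith
    have "Q y' - Q y = \<epsilon> * (d \<bullet> e) + k * ((norm (v y'))\<^sup>2 - (norm (v y))\<^sup>2) + k * ((m y')\<^sup>2 - (m y)\<^sup>2)"
      by (simp add: Q_def s' algebra_simps)
    also have "\<dots> \<le> \<epsilon> * (d \<bullet> e) + k * (2 * (v y \<bullet> d) + (norm d)\<^sup>2) + k * (2 * m y * (d \<bullet> e) + (norm d)\<^sup>2)"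
      using 1 2 k0 by (intro add_mono mult_left_mono order.refl) auto
    also have "\<dots> = - (z \<bullet> d) + 2 * k * (norm d)\<^sup>2"
      by (simp add: z_def inner_add_left inner_commute[of e d] algebra_simps)
    finally show ?thesis by (simp add: d_def)
  qed
  have "\<forall>\<^sub>F y' in nhds y. f y + z \<bullet> (y' - y) - (2 * k) * (norm (y' - y))\<^sup>2 \<le> f y'"
    using ev
  proof eventually_elim
    case (elim y')
    show ?case using ymin[OF elim] Q_le[of y'] by linarith
  qed
  then have "proximal_subgradient f y z"
    unfolding proximal_subgradient_def by blast
  \<comment> \<open>\<open>v y\<close> is orthogonal to \<open>e\<close> and \<open>m y\<close> is
    nonpositive, so only the tilt can push the product below zero, by at most
    \<open>\<epsilon>\<close>.\<close>
  moreover have "z \<bullet> e = - \<epsilon> - 2 * k * m y"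
    by (simp add: z_def v_def s_def inner_add_left inner_diff_left ee)
  then have "- \<epsilon> \<le> z \<bullet> e"
    using k0 by (simp add: m_def mult_nonneg_nonpos)
  ultimately show ?thesis
    using that K_ball[OF y] by blast
qed

section \<open>Quasiconvexity along a line\<close>

text \<open>As a midpoint, \<open>x\<close> cannot exceed both ends of a short symmetric segment.
  The mean value theorem on the half with the higher end gives a slope whose sign compares correctly
  with the zero slope at \<open>x\<close>.\<close>

lemma quasiconvex_derivative_increment:
  fixes \<phi> :: "'a::euclidean_space \<Rightarrow> real"
  assumes diff: "\<And>y. \<phi> differentiable (at y)" and qc: "quasiconvex \<phi>"
    and x: "gradient \<phi> x \<bullet> u = 0" and \<eta>: "\<eta> > 0"
  obtains c t where "0 < t" "\<bar>c\<bar> < \<eta>" "\<bar>c + t\<bar> < \<eta>"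
    "gradient \<phi> (x + c *\<^sub>R u) \<bullet> u \<le> gradient \<phi> (x + (c + t) *\<^sub>R u) \<bullet> u"
proof -
  define g where "g s = \<phi> (x + s *\<^sub>R u)" for s
  define g' where "g' s = gradient \<phi> (x + s *\<^sub>R u) \<bullet> u" for s
  have der: "(g has_real_derivative g' s) (at s)" for s
  proof -
    have "((\<lambda>s. x + s *\<^sub>R u) has_derivative (\<lambda>h. h *\<^sub>R u)) (at s)"
      by (auto intro!: derivative_eq_intros)
    moreover have "(\<phi> has_derivative (\<lambda>h. h \<bullet> gradient \<phi> (x + s *\<^sub>R u))) (at (x + s *\<^sub>R u))"
      using GDERIV_gradient[OF diff] by (simp add: gderiv_def)
    ultimately have "(g has_derivative (\<lambda>h. (h *\<^sub>R u) \<bullet> gradient \<phi> (x + s *\<^sub>R u))) (at s)"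
      unfolding g_def by (rule has_derivative_compose)
    moreover have "(\<lambda>h. (h *\<^sub>R u) \<bullet> gradient \<phi> (x + s *\<^sub>R u)) = (*) (g' s)"
      by (auto simp: g'_def inner_commute)
    ultimately show ?thesis
      by (simp add: has_field_derivative_def)
  qed
  have "(1 - 1/2) *\<^sub>R (x + (- (\<eta> / 2)) *\<^sub>R u) + (1/2) *\<^sub>R (x + (\<eta> / 2) *\<^sub>R u) = x"
    by (simp add: algebra_simps flip: scaleR_add_left)
  moreover have "(1/2 :: real) \<in> {0..1}" by simp
  ultimately have "g 0 \<le> max (g (- (\<eta> / 2))) (g (\<eta> / 2))"
    using qc unfolding quasiconvex_def g_def by (metis add.right_neutral scaleR_zero_left)
  then consider "g 0 \<le> g (\<eta> / 2)" | "g 0 \<le> g (- (\<eta> / 2))"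
    by (auto simp: max_def split: if_splits)
  then show ?thesis
  proof cases
    case 1
    obtain c where c: "0 < c" "c < \<eta> / 2" "g (\<eta> / 2) - g 0 = (\<eta> / 2 - 0) * g' c"
      using MVT2[of 0 "\<eta> / 2" g g'] der \<eta> by auto
    have "0 \<le> (\<eta> / 2) * g' c" using c(3) 1 by simp
    then have "0 \<le> g' c" using \<eta> by (simp add: zero_le_mult_iff)
    \<comment> \<open>The pair starts at \<open>x\<close>: offset \<open>0\<close> and increment
      \<open>c\<close>. In the other case it ends at \<open>x\<close>: offset \<open>c\<close> and
      increment \<open>- c\<close>.\<close>
    then show ?thesis
      using that[of c 0] c x \<eta> by (simp add: g'_def)
  next
    case 2
    obtain c where c: "- (\<eta> / 2) < c" "c < 0" "g 0 - g (- (\<eta> / 2)) = (0 - (- (\<eta> / 2))) * g' c"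
      using MVT2[of "- (\<eta> / 2)" 0 g g'] der \<eta> by auto
    have "(\<eta> / 2) * g' c \<le> 0" using c(3) 2 by simp
    then have "g' c \<le> 0" using \<eta> by (simp add: mult_le_0_iff)
    then show ?thesis
      using that[of "- c" c] c x \<eta> by (simp add: g'_def)
  qed
qed

section \<open>Passage to the limiting normal cone\<close>

lemma second_order_subdifferential_quasiconvex:
  fixes \<phi> :: "'a::euclidean_space \<Rightarrow> real"
  assumes smooth: "C11_smooth \<phi>" and qc: "quasiconvex \<phi>" and x: "gradient \<phi> x \<bullet> u = 0"
  obtains z where "z \<in> second_order_subdifferential \<phi> x u" "z \<bullet> u \<ge> 0"
proof -
  define F where "F = gradient \<phi>"
  have diff: "\<phi> differentiable (at y)" for y
    using smooth by (simp add: C11_smooth_def)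
  obtain r L where r: "r > 0" and lipF: "L-lipschitz_on (ball x r) F"
    using smooth unfolding C11_smooth_def locally_lipschitz_def F_def by blast
  have lip: "(L * norm u)-lipschitz_on (ball x r) (\<lambda>y. F y \<bullet> u)"
  proof (rule lipschitz_onI)
    fix y y' assume y: "y \<in> ball x r" "y' \<in> ball x r"
    have "dist (F y \<bullet> u) (F y' \<bullet> u) = \<bar>(F y - F y') \<bullet> u\<bar>"
      by (simp add: dist_norm inner_diff_left)
    also have "\<dots> \<le> dist (F y) (F y') * norm u"
      by (simp add: dist_norm Cauchy_Schwarz_ineq2)
    also have "\<dots> \<le> (L * dist y y') * norm u"
      using lipschitz_onD[OF lipF y] by (intro mult_right_mono) auto
    finally show "dist (F y \<bullet> u) (F y' \<bullet> u) \<le> L * norm u * dist y y'"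
      by (simp add: mult_ac)
  qed (use lipschitz_on_nonneg[OF lipF] in auto)
  have near: "\<exists>y z. y \<in> ball x \<delta> \<and> proximal_subgradient (\<lambda>y. F y \<bullet> u) y z \<and> - \<delta> \<le> z \<bullet> u"
    if \<delta>: "0 < \<delta>" "\<delta> \<le> r" for \<delta>
  proof (cases "u = 0")
    case True
    then have "proximal_subgradient (\<lambda>y. F y \<bullet> u) x 0"
      unfolding proximal_subgradient_def by (intro exI[of _ 0]) simp
    then show ?thesis using \<delta> by (intro exI[of _ x] exI[of _ 0]) simp
  next
    case False
    \<comment> \<open>The scale \<open>\<delta> / norm u\<close> puts both points in the ball of
      radius \<open>\<delta>\<close>. The same number is the tolerance for the unit vector
      \<open>e\<close>, so multiplying by \<open>norm u\<close> restores
      \<open>\<delta>\<close>.\<close>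
    obtain c t where ct: "0 < t" "\<bar>c\<bar> < \<delta> / norm u" "\<bar>c + t\<bar> < \<delta> / norm u"
        "F (x + c *\<^sub>R u) \<bullet> u \<le> F (x + (c + t) *\<^sub>R u) \<bullet> u"
      using quasiconvex_derivative_increment[OF diff qc x, of "\<delta> / norm u"] \<delta> False
      unfolding F_def by (metis divide_pos_pos zero_less_norm_iff)
    define e where "e = u /\<^sub>R norm u"
    have u: "u = norm u *\<^sub>R e" using False by (simp add: e_def)
    have b: "x + c *\<^sub>R u + (t * norm u) *\<^sub>R e = x + (c + t) *\<^sub>R u"
      using False by (simp add: e_def algebra_simps)
    have lip': "(L * norm u)-lipschitz_on (ball x \<delta>) (\<lambda>y. F y \<bullet> u)"
      using lip by (rule lipschitz_on_subset) (use \<delta> in auto)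
    obtain y z where yz: "y \<in> ball x \<delta>" "proximal_subgradient (\<lambda>y. F y \<bullet> u) y z"
        "- (\<delta> / norm u) \<le> z \<bullet> e"
    proof (rule proximal_mean_value_inequality[OF lip', of e "t * norm u" "x + c *\<^sub>R u" "\<delta> / norm u"])
      show "norm e = 1" using False by (simp add: e_def)
      show "x + c *\<^sub>R u + (t * norm u) *\<^sub>R e \<in> ball x \<delta>" "x + c *\<^sub>R u \<in> ball x \<delta>"
        unfolding b using ct False by (simp_all add: dist_norm pos_less_divide_eq)
      show "F (x + c *\<^sub>R u) \<bullet> u \<le> F (x + c *\<^sub>R u + (t * norm u) *\<^sub>R e) \<bullet> u"
        unfolding b by (rule ct)
    qed (use ct \<delta> False in auto)
    have "norm u * (- (\<delta> / norm u)) \<le> norm u * (z \<bullet> e)"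
      using yz(3) by (rule mult_left_mono) simp
    also have "norm u * (z \<bullet> e) = z \<bullet> u"
      using u by (metis inner_scaleR_right)
    finally have "- \<delta> \<le> z \<bullet> u"
      using False by simp
    with yz show ?thesis by blast
  qed
  \<comment> \<open>\<open>Suc n\<close> keeps every radius at most \<open>r\<close>, so one
    Lipschitz constant bounds all \<open>z n\<close>.\<close>
  define \<delta> where "\<delta> n = r / real (Suc n)" for n
  have \<delta>: "0 < \<delta> n" "\<delta> n \<le> r" for n
    using r by (auto simp: \<delta>_def field_simps)
  have \<delta>0: "\<delta> \<longlonglongrightarrow> 0"
    unfolding \<delta>_def by (rule LIMSEQ_Suc[OF lim_const_over_n])
  obtain y z where y: "\<And>n. y n \<in> ball x (\<delta> n)"
    and z: "\<And>n. proximal_subgradient (\<lambda>y. F y \<bullet> u) (y n) (z n)"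
    and zu: "\<And>n. - \<delta> n \<le> z n \<bullet> u"
    using near[OF \<delta>] by metis
  have y_ball: "y n \<in> ball x r" for n
    using y[of n] \<delta>(2)[of n] by simp
  have "norm (z n) \<le> L * norm u" for n
    using norm_proximal_subgradient_le[OF lip _ y_ball z] by simp
  then have "bounded (range z)"
    by (auto simp: bounded_iff)
  then obtain l \<sigma> where \<sigma>: "strict_mono \<sigma>" and zl: "(z \<circ> \<sigma>) \<longlonglongrightarrow> l"
    using bounded_imp_convergent_subsequence by blast
  have yx: "(\<lambda>n. y (\<sigma> n)) \<longlonglongrightarrow> x"
  proof -
    have "(\<lambda>n. dist (y n) x) \<longlonglongrightarrow> 0"
      by (rule tendsto_sandwich[OF _ _ tendsto_const \<delta>0])
        (use y in \<open>auto simp: dist_commute intro!: always_eventually less_imp_le\<close>)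
    then have "y \<longlonglongrightarrow> x" by (rule tendsto_dist_iff[THEN iffD2])
    from LIMSEQ_subseq_LIMSEQ[OF this \<sigma>] show ?thesis by (simp add: o_def)
  qed
  have "continuous_on (ball x r) F"
    by (rule lipschitz_on_continuous_on[OF lipF])
  then have "isCont F x"
    using r by (simp add: continuous_on_eq_continuous_at)
  then have Fy: "(\<lambda>n. F (y (\<sigma> n))) \<longlonglongrightarrow> F x"
    using yx by (rule isCont_tendsto_compose)
  \<comment> \<open>All base points lie on the graph, so the convergence of function values required
    by the limiting subdifferential is that of a constant sequence.\<close>
  have ind: "indicator_fun (graph_of F) (y, F y) = 0" for y
    by (simp add: indicator_fun_def graph_of_def)
  have "(l, - u) \<in> mordukhovich_subdifferential (indicator_fun (graph_of F)) (x, F x)"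
    unfolding mordukhovich_subdifferential_def
  proof (intro CollectI conjI exI allI)
    show "(\<lambda>n. (y (\<sigma> n), F (y (\<sigma> n)))) \<longlonglongrightarrow> (x, F x)"
      by (intro tendsto_Pair yx Fy)
    show "(\<lambda>n. (z (\<sigma> n), - u)) \<longlonglongrightarrow> (l, - u)"
      using zl by (intro tendsto_Pair tendsto_const) (simp add: o_def)
    show "(z (\<sigma> n), - u) \<in> frechet_subdifferential (indicator_fun (graph_of F)) (y (\<sigma> n), F (y (\<sigma> n)))" for n
      by (rule proximal_subgradient_imp_frechet_normal[OF z])
  qed (simp_all add: ind)
  then have "l \<in> second_order_subdifferential \<phi> x u"
    by (simp add: second_order_subdifferential_def mordukhovich_coderivative_def
        mordukhovich_normal_cone_def F_def)
  moreover have "0 \<le> l \<bullet> u"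
  proof (rule LIMSEQ_le)
    show "(\<lambda>n. - \<delta> (\<sigma> n)) \<longlonglongrightarrow> 0"
      using tendsto_minus[OF LIMSEQ_subseq_LIMSEQ[OF \<delta>0 \<sigma>]] by (simp add: o_def)
    show "(\<lambda>n. z (\<sigma> n) \<bullet> u) \<longlonglongrightarrow> l \<bullet> u"
      using zl by (intro tendsto_intros) (simp add: o_def)
  qed (use zu in auto)
  ultimately show ?thesis by (rule that)
qed

theorem theorem3p2:
  fixes \<phi> :: "real ^ 'n \<Rightarrow> real"
  assumes "C11_smooth \<phi>" and "quasiconvex \<phi>"
  shows "\<forall>x u. gradient \<phi> x \<bullet> u = 0 \<longrightarrow>
           (\<exists>z \<in> second_order_subdifferential \<phi> x u. z \<bullet> u \<ge> 0)"
  using second_order_subdifferential_quasiconvex[OF assms] by metis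

end
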